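(* Let $(W_n)_{n\ge0}$ be the wealth process of some betting strategy with bet fractions $(\lambda_n)_{n\ge1}$, let $\rho\in(0,1)$, and let $N^\rho=\bigcap_{n=1}^\infty\{\widehat W_n>\rho\}$ be its $\rho$-predictably non-bankrupt event, where $$\widehat W_n=\min_{x\in[0,1]}W_{n-1}\bigl(1+\lambda_n(x-m)\bigr).$$ Then there exists another betting strategy whose wealth process $(W_n^\sharp)$ satisfies $W_n^\sharp=\frac{W_n-\rho}{1-\rho}$ for all $n$ on the event $N^\rho$. Consequently, on the event $N^\rho$ (i.e., after intersecting each event below with $N^\rho$): $$\{W_n>1\}\subseteq\{W_n^\sharp>W_n\},\qquad\{W_n\to\infty\}\subseteq\Bigl\{\liminf_n W_n^\sharp/W_n=\tfrac1{1-\rho}>1\Bigr\};$$ $$\{W_n<1\}\subseteq\{W_n^\sharp<W_n\},\qquad\{W_\infty<1\}\subseteq\Bigl\{W_\infty^\sharp=\tfrac{W_\infty-\rho}{1-\rho}<W_\infty\Bigr\}.$$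
   Context: Fix $m\in(0,1)$ and a sequence $X_1,X_2,\dots$ of $[0,1]$-valued random variables. A betting strategy is a process $(\lambda_n)_{n\ge1}$ with values in $[-\frac1{1-m},\frac1m]$ that is predictable, i.e. $\lambda_n$ is $\sigma(X_1,\dots,X_{n-1})$-measurable for each $n$. Its wealth process is $W_0=1$, $W_n=\prod_{k=1}^n(1+\lambda_k(X_k-m))$. $W_\infty$ and $W_\infty^\sharp$ denote the limits of $W_n$ and $W_n^\sharp$ as $n\to\infty$; the event $\{W_\infty<1\}$ means that the limit $W_\infty$ exists and is less than $1$. *)

theory Defs
  imports "HOL-Probability.Probability"
begin

text \<open>All processes are functions of type \<open>nat \<Rightarrow> 'a \<Rightarrow> real\<close>.  The processes \<open>X\<close> and \<open>lam\<close> are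
  indexed from 1; their values at index 0 are never used.\<close>

text \<open>The \<open>\<sigma>\<close>-algebra \<open>\<sigma>(X\<^sub>1, \<dots>, X\<^sub>n\<^sub>-\<^sub>1)\<close> on the sample space; it is trivial for \<open>n = 1\<close>.\<close>

definition past :: "'a measure \<Rightarrow> (nat \<Rightarrow> 'a \<Rightarrow> real) \<Rightarrow> nat \<Rightarrow> 'a measure" where
  "past M X n = sigma (space M) (\<Union>k\<in>{1..<n}. {X k -` A \<inter> space M | A. A \<in> sets borel})"

definition betting_strategy ::
    "'a measure \<Rightarrow> (nat \<Rightarrow> 'a \<Rightarrow> real) \<Rightarrow> real \<Rightarrow> (nat \<Rightarrow> 'a \<Rightarrow> real) \<Rightarrow> bool" where
  "betting_strategy M X m lam \<longleftrightarrow>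
     (\<forall>n\<ge>1. lam n \<in> borel_measurable (past M X n)) \<and>
     (\<forall>n\<ge>1. \<forall>\<omega>\<in>space M. lam n \<omega> \<in> {- (1 / (1 - m)) .. 1 / m})"

definition wealth ::
    "(nat \<Rightarrow> 'a \<Rightarrow> real) \<Rightarrow> real \<Rightarrow> (nat \<Rightarrow> 'a \<Rightarrow> real) \<Rightarrow> nat \<Rightarrow> 'a \<Rightarrow> real" where
  "wealth X m lam n \<omega> = (\<Prod>k=1..n. 1 + lam k \<omega> * (X k \<omega> - m))"

text \<open>The worst possible wealth after round \<open>n\<close>, used only for \<open>n \<ge> 1\<close>.  The infimum is a minimum,
  see \<open>worst_wealth_attained\<close> and \<open>worst_wealth_le\<close> below.\<close>

definition worst_wealth ::
    "(nat \<Rightarrow> 'a \<Rightarrow> real) \<Rightarrow> real \<Rightarrow> (nat \<Rightarrow> 'a \<Rightarrow> real) \<Rightarrow> nat \<Rightarrow> 'a \<Rightarrow> real" where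
  "worst_wealth X m lam n \<omega> =
     (INF x\<in>{0..1}. wealth X m lam (n - 1) \<omega> * (1 + lam n \<omega> * (x - m)))"

lemma compact_worst_wealth:
  "compact ((\<lambda>x. wealth X m lam (n - 1) \<omega> * (1 + lam n \<omega> * (x - m))) ` {0..1::real})"
  by (intro compact_continuous_image continuous_intros) auto

lemma worst_wealth_attained:
  "\<exists>x\<in>{0..1}. worst_wealth X m lam n \<omega> = wealth X m lam (n - 1) \<omega> * (1 + lam n \<omega> * (x - m))"
proof -
  let ?S = "(\<lambda>x. wealth X m lam (n - 1) \<omega> * (1 + lam n \<omega> * (x - m))) ` {0..1::real}"
  have "Inf ?S \<in> ?S"
    using compact_worst_wealth[of X m lam n \<omega>]
    by (intro closed_contains_Inf) (auto intro: compact_imp_closed bounded_imp_bdd_below compact_imp_bounded)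
  then show ?thesis
    by (auto simp: worst_wealth_def)
qed

lemma worst_wealth_le:
  assumes "x \<in> {0..1}"
  shows "worst_wealth X m lam n \<omega> \<le> wealth X m lam (n - 1) \<omega> * (1 + lam n \<omega> * (x - m))"
  unfolding worst_wealth_def using assms
  by (intro cINF_lower bounded_imp_bdd_below compact_imp_bounded compact_worst_wealth)

definition non_bankrupt ::
    "'a measure \<Rightarrow> (nat \<Rightarrow> 'a \<Rightarrow> real) \<Rightarrow> real \<Rightarrow> (nat \<Rightarrow> 'a \<Rightarrow> real) \<Rightarrow> real \<Rightarrow> 'a set" where
  "non_bankrupt M X m lam \<rho> = (\<Inter>n\<in>{1..}. {\<omega>\<in>space M. worst_wealth X m lam n \<omega> > \<rho>})"

end

theory Submission
  imports Defs
begin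

text \<open>Since \<open>W\<^sub>n - \<rho> = (W\<^sub>n\<^sub>-\<^sub>1 - \<rho>) (1 + \<mu>\<^sub>n (X\<^sub>n - m))\<close> with
  \<open>\<mu>\<^sub>n = \<lambda>\<^sub>n W\<^sub>n\<^sub>-\<^sub>1 / (W\<^sub>n\<^sub>-\<^sub>1 - \<rho>)\<close>, betting the fraction \<open>\<mu>\<^sub>n\<close> amounts to locking away the capital \<open>\<rho>\<close>
  and playing the original strategy with the rest.  Non-bankruptcy tested at \<open>x = 0\<close> and \<open>x = 1\<close> says
  that \<open>\<mu>\<^sub>n\<close> is an admissible bet, so truncating \<open>\<mu>\<^sub>n\<close> to the admissible interval, which makes it a
  strategy everywhere, changes nothing on the non-bankrupt event.\<close>

lemma wealth_0 [simp]: "wealth X m lam 0 \<omega> = 1"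
  by (simp add: wealth_def)

lemma wealth_Suc:
  "wealth X m lam (Suc n) \<omega> = wealth X m lam n \<omega> * (1 + lam (Suc n) \<omega> * (X (Suc n) \<omega> - m))"
  by (simp add: wealth_def)

lemma space_past [simp]: "space (past M X n) = space M"
  by (simp add: past_def space_measure_of_conv)

lemma sets_past:
  "sets (past M X n) =
    sigma_sets (space M) (\<Union>k\<in>{1..<n}. {X k -` A \<inter> space M | A. A \<in> sets borel})"
  unfolding past_def by (rule sets_measure_of) auto

lemma measurable_past_mono:
  assumes "k \<le> n" "f \<in> measurable (past M X k) L"
  shows "f \<in> measurable (past M X n) L"
proof -
  have "sets (past M X k) \<subseteq> sets (past M X n)"
    unfolding sets_past using assms(1) by (intro sigma_sets_mono') fastforce
  then show ?thesis
    using assms(2) by (auto simp: measurable_def)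
qed

lemma measurable_past_component:
  assumes "1 \<le> k" "k < n"
  shows "X k \<in> borel_measurable (past M X n)"
proof (rule measurableI)
  fix A :: "real set" assume "A \<in> sets borel"
  then show "X k -` A \<inter> space (past M X n) \<in> sets (past M X n)"
    unfolding sets_past space_past using assms by (intro sigma_sets.Basic UN_I[of k]) auto
qed simp

text \<open>Only bets and outcomes of rounds before \<open>n\<close> enter the product, and a bet
  known before an earlier round is still known before round \<open>n\<close>. This makes a bet in
  round \<open>n\<close> that depends on the current capital predictable.\<close>

lemma measurable_past_wealth:
  assumes "betting_strategy M X m lam" "1 \<le> n"
  shows "wealth X m lam (n - 1) \<in> borel_measurable (past M X n)"
proof -
  have "lam k \<in> borel_measurable (past M X n)" "X k \<in> borel_measurable (past M X n)"
    if "k \<in> {1..n - 1}" for k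
  proof -
    have "1 \<le> k" "k < n" using that assms(2) by auto
    then show "lam k \<in> borel_measurable (past M X n)" "X k \<in> borel_measurable (past M X n)"
      using assms(1) measurable_past_mono[of k n "lam k"] measurable_past_component[of k n X M]
      by (auto simp: betting_strategy_def)
  qed
  then have "(\<lambda>\<omega>. \<Prod>k=1..n - 1. 1 + lam k \<omega> * (X k \<omega> - m)) \<in> borel_measurable (past M X n)"
    by (intro borel_measurable_prod borel_measurable_add borel_measurable_times
        borel_measurable_diff borel_measurable_const)
  then show ?thesis
    by (simp add: wealth_def[abs_def])
qed

text \<open>Off the non-bankrupt event the quotient may leave the admissible interval, and where the
  capital equals \<open>\<rho>\<close> it is 0 by the convention on division; the clamping by
  \<open>max\<close> and \<open>min\<close> covers all these cases.\<close>

definition insured ::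
    "(nat \<Rightarrow> 'a \<Rightarrow> real) \<Rightarrow> real \<Rightarrow> real \<Rightarrow> (nat \<Rightarrow> 'a \<Rightarrow> real) \<Rightarrow> nat \<Rightarrow> 'a \<Rightarrow> real" where
  "insured X m \<rho> lam n \<omega> = max (- (1 / (1 - m))) (min (1 / m)
     (lam n \<omega> * wealth X m lam (n - 1) \<omega> / (wealth X m lam (n - 1) \<omega> - \<rho>)))"

lemma betting_strategy_insured:
  assumes "betting_strategy M X m lam" "0 < m" "m < 1"
  shows "betting_strategy M X m (insured X m \<rho> lam)"
  unfolding betting_strategy_def
proof (intro conjI allI impI ballI)
  fix n :: nat assume n: "1 \<le> n"
  note measurable_past_wealth[OF assms(1) n, measurable]
  have [measurable]: "lam n \<in> borel_measurable (past M X n)"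
    using assms(1) n by (auto simp: betting_strategy_def)
  show "insured X m \<rho> lam n \<in> borel_measurable (past M X n)"
    unfolding insured_def[abs_def] by measurable
next
  \<comment> \<open>The endpoints are in the right order, so the outer \<open>max\<close> cannot
    push the value above \<open>1 / m\<close>.\<close>
  have "- (1 / (1 - m)) \<le> 0" "0 \<le> 1 / m" using assms by auto
  then have "- (1 / (1 - m)) \<le> 1 / m" by (rule order_trans)
  then show "insured X m \<rho> lam n \<omega> \<in> {- (1 / (1 - m))..1 / m}" for n \<omega>
    by (auto simp: insured_def)
qed

lemma non_bankruptD:
  assumes "\<omega> \<in> non_bankrupt M X m lam \<rho>" "x \<in> {0..1}"
  shows "\<rho> < wealth X m lam n \<omega> * (1 + lam (Suc n) \<omega> * (x - m))"
proof -
  have "\<rho> < worst_wealth X m lam (Suc n) \<omega>"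
    using assms(1) by (auto simp: non_bankrupt_def)
  with worst_wealth_le[OF assms(2), of X m lam "Suc n" \<omega>] show ?thesis
    by simp
qed

text \<open>The outcome \<open>x = m\<close> leaves the capital unchanged whatever the bet, so the
  worst case never exceeds the capital before the round.\<close>

lemma wealth_gt_non_bankrupt:
  assumes "\<omega> \<in> non_bankrupt M X m lam \<rho>" "0 < m" "m < 1"
  shows "\<rho> < wealth X m lam n \<omega>"
  using non_bankruptD[OF assms(1), of m n] assms(2,3) by simp

lemma insured_non_bankrupt:
  assumes "\<omega> \<in> non_bankrupt M X m lam \<rho>" "0 < m" "m < 1"
  shows "insured X m \<rho> lam (Suc n) \<omega> =
    lam (Suc n) \<omega> * wealth X m lam n \<omega> / (wealth X m lam n \<omega> - \<rho>)"
proof -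
  let ?w = "wealth X m lam n \<omega>" and ?l = "lam (Suc n) \<omega>"
  have pos: "0 < ?w - \<rho>"
    using wealth_gt_non_bankrupt[OF assms] by simp
  \<comment> \<open>The outcome \<open>x = 0\<close> caps the bet from above.\<close>
  have "?l * ?w * m \<le> ?w - \<rho>"
    using non_bankruptD[OF assms(1), of 0 n] by (simp add: algebra_simps)
  then have le: "?l * ?w / (?w - \<rho>) \<le> 1 / m"
    using pos assms by (simp add: field_simps)
  \<comment> \<open>The outcome \<open>x = 1\<close> caps it from below.\<close>
  have "- (?w - \<rho>) \<le> ?l * ?w * (1 - m)"
    using non_bankruptD[OF assms(1), of 1 n] by (simp add: algebra_simps)
  then have "- (1 / (1 - m)) \<le> ?l * ?w / (?w - \<rho>)"
    using pos assms by (simp add: field_simps)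
  with le show ?thesis
    by (simp add: insured_def)
qed

lemma wealth_insured:
  assumes "\<omega> \<in> non_bankrupt M X m lam \<rho>" "0 < m" "m < 1" "\<rho> < 1"
  shows "wealth X m (insured X m \<rho> lam) n \<omega> = (wealth X m lam n \<omega> - \<rho>) / (1 - \<rho>)"
proof (induction n)
  case 0
  then show ?case using assms by simp
next
  case (Suc n)
  let ?w = "wealth X m lam n \<omega>" and ?l = "lam (Suc n) \<omega>" and ?x = "X (Suc n) \<omega> - m"
  have "?w - \<rho> \<noteq> 0"
    using wealth_gt_non_bankrupt[OF assms(1-3), of n] by simp
  then have "(?w - \<rho>) * (1 + ?l * ?w / (?w - \<rho>) * ?x) = ?w * (1 + ?l * ?x) - \<rho>"
    by (simp add: distrib_left)
  then show ?case
    by (simp add: wealth_Suc Suc insured_non_bankrupt[OF assms(1-3)])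
qed

text \<open>The difference of the two capitals is \<open>\<rho> * (w - 1) / (1 - \<rho>)\<close>,
  which has the sign of \<open>w - 1\<close>.\<close>

lemma insured_capital_gt_iff:
  fixes w \<rho> :: real
  assumes "0 < \<rho>" "\<rho> < 1"
  shows "w < (w - \<rho>) / (1 - \<rho>) \<longleftrightarrow> 1 < w"
proof -
  have "w < (w - \<rho>) / (1 - \<rho>) \<longleftrightarrow> \<rho> * 1 < \<rho> * w"
    using assms by (simp add: less_divide_eq algebra_simps)
  then show ?thesis using assms by simp
qed

lemma insured_capital_less_iff:
  fixes w \<rho> :: real
  assumes "0 < \<rho>" "\<rho> < 1"
  shows "(w - \<rho>) / (1 - \<rho>) < w \<longleftrightarrow> w < 1"
proof -
  have "(w - \<rho>) / (1 - \<rho>) < w \<longleftrightarrow> \<rho> * w < \<rho> * 1"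
    using assms by (simp add: divide_less_eq algebra_simps)
  then show ?thesis using assms by simp
qed

lemma insured_capital_ratio_tendsto:
  fixes w :: "nat \<Rightarrow> real"
  assumes "filterlim w at_top sequentially"
  shows "(\<lambda>n. (w n - \<rho>) / (1 - \<rho>) / w n) \<longlonglongrightarrow> 1 / (1 - \<rho>)"
proof -
  have "(\<lambda>n. \<rho> / w n) \<longlonglongrightarrow> 0"
    using assms by (intro real_tendsto_divide_at_top[OF tendsto_const])
  then have "(\<lambda>n. (1 - \<rho> / w n) * (1 / (1 - \<rho>))) \<longlonglongrightarrow> (1 - 0) * (1 / (1 - \<rho>))"
    by (intro tendsto_intros)
  \<comment> \<open>Cancelling \<open>w n\<close> requires it to be nonzero, which divergence to
    infinity guarantees only from some index on.\<close>
  moreover have "\<forall>\<^sub>F n in sequentially.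
      (1 - \<rho> / w n) * (1 / (1 - \<rho>)) = (w n - \<rho>) / (1 - \<rho>) / w n"
    using filterlim_at_top_dense[THEN iffD1, OF assms, rule_format, of 0]
    by eventually_elim (simp add: diff_divide_distrib)
  ultimately show ?thesis
    by (simp add: Lim_transform_eventually)
qed

theorem theorem4p1:
  fixes M :: "'a measure" and X lam :: "nat \<Rightarrow> 'a \<Rightarrow> real" and m \<rho> :: real
  assumes "prob_space M"
    and "0 < m" and "m < 1"
    and "\<And>n. n \<ge> 1 \<Longrightarrow> X n \<in> borel_measurable M"
    and "\<And>n \<omega>. n \<ge> 1 \<Longrightarrow> \<omega> \<in> space M \<Longrightarrow> X n \<omega> \<in> {0..1}"
    and "betting_strategy M X m lam"
    and "0 < \<rho>" and "\<rho> < 1"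
  defines "W \<equiv> wealth X m lam"
    and "N \<equiv> non_bankrupt M X m lam \<rho>"
  shows "\<exists>lam'. betting_strategy M X m lam' \<and>
    (let W' = wealth X m lam' in
      (\<forall>n. \<forall>\<omega>\<in>N. W' n \<omega> = (W n \<omega> - \<rho>) / (1 - \<rho>)) \<and>
      (\<forall>n. {\<omega>\<in>space M. W n \<omega> > 1} \<inter> N \<subseteq> {\<omega>\<in>space M. W' n \<omega> > W n \<omega>} \<inter> N) \<and>
      {\<omega>\<in>space M. filterlim (\<lambda>n. W n \<omega>) at_top sequentially} \<inter> N
        \<subseteq> {\<omega>\<in>space M. liminf (\<lambda>n. ereal (W' n \<omega> / W n \<omega>)) = ereal (1 / (1 - \<rho>)) \<and>
                         1 / (1 - \<rho>) > 1} \<inter> N \<and>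
      (\<forall>n. {\<omega>\<in>space M. W n \<omega> < 1} \<inter> N \<subseteq> {\<omega>\<in>space M. W' n \<omega> < W n \<omega>} \<inter> N) \<and>
      {\<omega>\<in>space M. convergent (\<lambda>n. W n \<omega>) \<and> lim (\<lambda>n. W n \<omega>) < 1} \<inter> N
        \<subseteq> {\<omega>\<in>space M. convergent (\<lambda>n. W' n \<omega>) \<and>
              lim (\<lambda>n. W' n \<omega>) = (lim (\<lambda>n. W n \<omega>) - \<rho>) / (1 - \<rho>) \<and>
              (lim (\<lambda>n. W n \<omega>) - \<rho>) / (1 - \<rho>) < lim (\<lambda>n. W n \<omega>)} \<inter> N)"
proof -
  define lam' where "lam' = insured X m \<rho> lam"
  have W': "wealth X m lam' n \<omega> = (W n \<omega> - \<rho>) / (1 - \<rho>)" if "\<omega> \<in> N" for n \<omega>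
    using that wealth_insured assms by (simp add: W_def N_def lam'_def)
  \<comment> \<open>The ratio has a genuine limit, and the liminf is equal to it.\<close>
  have liminf: "liminf (\<lambda>n. ereal ((W n \<omega> - \<rho>) / (1 - \<rho>) / W n \<omega>)) = ereal (1 / (1 - \<rho>))"
    if "filterlim (\<lambda>n. W n \<omega>) at_top sequentially" for \<omega>
    using insured_capital_ratio_tendsto[OF that, of \<rho>]
    by (intro lim_imp_Liminf) simp_all
  have lim: "(\<lambda>n. (W n \<omega> - \<rho>) / (1 - \<rho>)) \<longlonglongrightarrow> (lim (\<lambda>n. W n \<omega>) - \<rho>) / (1 - \<rho>)"
    if "convergent (\<lambda>n. W n \<omega>)" for \<omega>
    using that assms by (auto simp: convergent_LIMSEQ_iff intro!: tendsto_intros)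
  have "betting_strategy M X m lam'"
    unfolding lam'_def using assms by (intro betting_strategy_insured)
  moreover have "1 / (1 - \<rho>) > 1"
    using \<open>0 < \<rho>\<close> \<open>\<rho> < 1\<close> by simp
  ultimately show ?thesis
    unfolding Let_def using \<open>0 < \<rho>\<close> \<open>\<rho> < 1\<close>
    \<comment> \<open>On \<open>N\<close> every claim becomes one about the map
      \<open>w \<mapsto> (w - \<rho>) / (1 - \<rho>)\<close>; the comparison with \<open>w\<close>
      is applied to the limit of the wealth as well as to its values. Removing
      \<open>divide_divide_eq_left\<close> keeps the iterated quotient in the shape used by
      \<open>liminf\<close>.\<close>
    by (intro exI[of _ lam'])
      (auto simp: W' liminf limI[OF lim] convergentI[OF lim]
        insured_capital_gt_iff insured_capital_less_iff simp del: divide_divide_eq_left)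
qed

end
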